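(* For every integer $t\geq 2$, the graph $\Gamma_t=\Gamma_{\mathrm{Sh}}\,\square\,K_t$ (the Cartesian product of the Shrikhande graph $\Gamma_{\mathrm{Sh}}$ and the complete graph $K_t$) is connected and sesqui-regular with parameters $(n,k,c)=(16t,\,t+5,\,2)$. Moreover, $\lambda_{\min}(\Gamma_t)=-3$, and $\Gamma_t$ is not $1$-integrable.
   Context: All graphs are finite, undirected and simple. For a graph $G$, $A(G)$ is its adjacency matrix and $\lambda_{\min}(G)$ is the smallest eigenvalue of $A(G)$; $N_G(x)$ is the set of neighbors of $x$ and $\operatorname{dist}_G$ is the graph distance. A $k$-regular graph $G$ on $n$ vertices is sesqui-regular with parameters $(n,k,c)$ if $|N_G(x)\cap N_G(y)|=c$ whenever $\operatorname{dist}_G(x,y)=2$. For a positive integer $s$, a graph $G$ is $s$-integrable if there exists an integral matrix $N$ such that $A(G)+\lceil-\lambda_{\min}(G)\rceil I=\frac1s N^{\mathsf T}N$. The Cartesian product $G\square H$ has vertex set $V(G)\times V(H)$, with $(x,i)$ and $(y,j)$ adjacent precisely when either $x=y$ and $i\sim_H j$, or $i=j$ and $x\sim_G y$. The Shrikhande graph is the Cayley graph $\Gamma_{\mathrm{Sh}}=\operatorname{Cay}(\mathbb Z_4^2,\{\pm(1,0),\pm(0,1),\pm(1,1)\})$ (two elements adjacent iff their difference lies in the given set); it is strongly regular with parameters $(16,6,2,2)$. *)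

theory Defs
  imports
    "Graph_Theory.Pair_Digraph"
    "Graph_Theory.Digraph_Component"
    "Graph_Theory.Shortest_Path"
    "Jordan_Normal_Form.Char_Poly"
    "HOL-Library.Numeral_Type"
    "HOL-Library.Product_Plus"
begin

text \<open>
  A finite simple undirected graph is a \<open>pair_graph\<close>: a finite vertex set with a symmetric
  irreflexive set of ordered pairs, each edge being represented by both of its orientations.
\<close>

definition neighbors :: "'a pair_pre_digraph \<Rightarrow> 'a \<Rightarrow> 'a set" where
  "neighbors G x = {y. (x, y) \<in> parcs G}"

text \<open>Graph distance is the least cost of a walk with unit arc weights (infinite if there is none).\<close>

definition graph_dist :: "'a pair_pre_digraph \<Rightarrow> 'a \<Rightarrow> 'a \<Rightarrow> ereal" where
  "graph_dist G = wf_digraph.\<mu> (with_proj G) (\<lambda>_. 1)"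

definition sesqui_regular :: "'a pair_pre_digraph \<Rightarrow> nat \<Rightarrow> nat \<Rightarrow> nat \<Rightarrow> bool" where
  "sesqui_regular G n k c \<longleftrightarrow>
     pair_graph G \<and> card (pverts G) = n \<and>
     (\<forall>x\<in>pverts G. card (neighbors G x) = k) \<and>
     (\<forall>x\<in>pverts G. \<forall>y\<in>pverts G.
        graph_dist G x y = 2 \<longrightarrow> card (neighbors G x \<inter> neighbors G y) = c)"

text \<open>
  Matrices are indexed by \<open>{0..<n}\<close>, so the vertices are listed in an arbitrary but fixed order.
  Another order conjugates the adjacency matrix by a permutation matrix, which affects neither
  the spectrum nor integrability.
\<close>

definition vertex_list :: "'a pair_pre_digraph \<Rightarrow> 'a list" where
  "vertex_list G = (SOME xs. distinct xs \<and> set xs = pverts G)"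

definition adjacency_matrix :: "'a pair_pre_digraph \<Rightarrow> real mat" where
  "adjacency_matrix G =
     mat (card (pverts G)) (card (pverts G))
       (\<lambda>(i, j). if (vertex_list G ! i, vertex_list G ! j) \<in> parcs G then 1 else 0)"

definition lambda_min :: "'a pair_pre_digraph \<Rightarrow> real" where
  "lambda_min G = Min {k. eigenvalue (adjacency_matrix G) k}"

text \<open>The integral matrix \<open>N\<close> may have any number \<open>m\<close> of rows.\<close>

definition s_integrable :: "nat \<Rightarrow> 'a pair_pre_digraph \<Rightarrow> bool" where
  "s_integrable s G \<longleftrightarrow>
     0 < s \<and>
     (\<exists>m. \<exists>N \<in> carrier_mat m (card (pverts G)).
        adjacency_matrix G + of_int \<lceil>- lambda_min G\<rceil> \<cdot>\<^sub>m 1\<^sub>m (card (pverts G)) =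
        (1 / of_nat s) \<cdot>\<^sub>m map_mat real_of_int (N\<^sup>T * N))"

definition cartesian_product ::
    "'a pair_pre_digraph \<Rightarrow> 'b pair_pre_digraph \<Rightarrow> ('a \<times> 'b) pair_pre_digraph"
    (infixr \<open>\<box>\<close> 80) where
  "G \<box> H =
     \<lparr> pverts = pverts G \<times> pverts H,
       parcs = {((x, i), (y, j)).
                  x \<in> pverts G \<and> y \<in> pverts G \<and> i \<in> pverts H \<and> j \<in> pverts H \<and>
                  (x = y \<and> (i, j) \<in> parcs H \<or> i = j \<and> (x, y) \<in> parcs G)} \<rparr>"

definition complete_graph :: "nat \<Rightarrow> nat pair_pre_digraph" where
  "complete_graph t =
     \<lparr> pverts = {..<t}, parcs = {(i, j). i < t \<and> j < t \<and> i \<noteq> j} \<rparr>"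

definition cayley_graph :: "'a::group_add set \<Rightarrow> 'a pair_pre_digraph" where
  "cayley_graph S = \<lparr> pverts = UNIV, parcs = {(x, y). y - x \<in> S} \<rparr>"

text \<open>The numeral type \<open>4\<close> is the ring of integers modulo 4.\<close>

definition shrikhande_graph :: "(4 \<times> 4) pair_pre_digraph" where
  "shrikhande_graph =
     cayley_graph {(1, 0), - (1, 0), (0, 1), - (0, 1), (1, 1), - (1, 1)}"

end

theory Submission
  imports Defs
begin

text \<open>
  Seven functions \<open>phi\<close> on \<open>\<int>\<^sub>4 \<times> \<int>\<^sub>4\<close>, spanning the eigenspaces of the Shrikhande graph for 6 and 2, satisfy
  \<open>4I + 2A = \<Sum>\<^sub>a \<phi>\<^sub>a \<phi>\<^sub>a\<^sup>T\<close>. Hence \<open>A + 2I\<close> is positive semidefinite, which gives the smallest eigenvalue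
  \<open>-3\<close> of the product.

  Suppose the product is 1-integrable, let \<open>X\<^sub>p\<close> and \<open>Y\<^sub>p\<close> be the integral vectors representing two layers, and put
  \<open>d\<^sub>p = X\<^sub>p - Y\<^sub>p\<close> and \<open>s\<^sub>p = X\<^sub>p + Y\<^sub>p\<close>. Then \<open>d\<close> has Gram matrix \<open>4I + 2A\<close> and every \<open>s\<^sub>p\<close> is orthogonal to every \<open>d\<^sub>q\<close>.
  Therefore \<open>2 d\<^sub>p = \<Sum>\<^sub>a \<phi>\<^sub>a(p) w\<^sub>a\<close> with seven pairwise orthogonal vectors \<open>w\<^sub>a\<close> of squared norm 4. In every
  coordinate \<open>i\<close> the seven numbers \<open>w\<^sub>a(i)\<close> are integers forming a word of the Hamming code modulo 2, so
  \<open>m\<^sub>i = \<Sum>\<^sub>a w\<^sub>a(i)\<^sup>2\<close> is 0 or at least 3; Bessel's inequality gives \<open>m\<^sub>i \<le> 4\<close>. If \<open>m\<^sub>i = 4\<close>, then the \<open>i\<close>-th unit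
  vector lies in the span of the \<open>w\<^sub>a\<close>, so all \<open>s\<^sub>p(i)\<close> vanish, all \<open>d\<^sub>p(i)\<close> are even, and halving them yields a
  word of squared length 1, which is impossible. So every \<open>m\<^sub>i\<close> is 0 or 3, but their sum is \<open>7 \<cdot> 4 = 28\<close>.
\<close>

subsection \<open>A tight frame for the Shrikhande graph\<close>

text \<open>The real character part \<open>z \<mapsto> Re (\<i>\<^sup>z)\<close> of the integers modulo 4.\<close>

definition chi :: "4 \<Rightarrow> int" where
  "chi z = (if z = 0 then 1 else if z = 2 then -1 else 0)"

text \<open>The constant function, then the real and imaginary parts of the three characters i^x,
  i^y and i^(x-y), with i the imaginary unit: \<open>chi (z - 1)\<close> is the imaginary part of
  i^z.\<close>

definition phi :: "nat \<Rightarrow> 4 \<times> 4 \<Rightarrow> int" where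
  "phi a p = (case p of (x, y) \<Rightarrow>
     [1, chi x, chi (x - 1), chi y, chi (y - 1), chi (x - y), chi (x - y - 1)] ! a)"

lemma UNIV_4: "(UNIV :: 4 set) = {0, 1, 2, 3}"
proof -
  have "z \<in> {0, 1, 2, 3}" for z :: 4
  proof (cases z)
    case (of_int k)
    then have "k = 0 \<or> k = 1 \<or> k = 2 \<or> k = 3" by auto
    then show ?thesis using of_int by auto
  qed
  then show ?thesis by blast
qed

lemma cases_4: "(z :: 4) = 0 \<or> z = 1 \<or> z = 2 \<or> z = 3"
  using UNIV_4 by blast

definition connection_set :: "(4 \<times> 4) set" where
  "connection_set = {(1, 0), - (1, 0), (0, 1), - (0, 1), (1, 1), - (1, 1)}"

text \<open>The subtraction formula for the cosine at multiples of a quarter turn.\<close>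

lemma chi_mult: "chi u * chi v + chi (u - 1) * chi (v - 1) = chi (u - v)"
  using cases_4[of u] cases_4[of v] by (elim disjE) (simp_all add: chi_def)

lemma phi_simps:
  "phi 0 (x, y) = 1" "phi (Suc 0) (x, y) = chi x" "phi 2 (x, y) = chi (x - 1)"
  "phi 3 (x, y) = chi y" "phi 4 (x, y) = chi (y - 1)"
  "phi 5 (x, y) = chi (x - y)" "phi 6 (x, y) = chi (x - y - 1)"
  by (simp_all add: phi_def)

lemma lessThan_7: "{..<7::nat} = {0, 1, 2, 3, 4, 5, 6}"
  by auto

text \<open>Pairing each cosine with its sine through \<open>chi_mult\<close> leaves a function of
  the difference \<open>q - p\<close> alone, so sixteen values have to be inspected.\<close>

lemma phi_sum: "(\<Sum>a<7. phi a p * phi a q) = (if p = q then 4 else if q - p \<in> connection_set then 2 else 0)"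
proof -
  obtain x y z w where p: "p = (x, y)" "q = (z, w)" by fastforce
  define u v where "u = z - x" and "v = w - y"
  have "(\<Sum>a<7. phi a p * phi a q) = 1 + (chi z * chi x + chi (z - 1) * chi (x - 1)) +
     (chi w * chi y + chi (w - 1) * chi (y - 1)) +
     (chi (z - w) * chi (x - y) + chi (z - w - 1) * chi (x - y - 1))"
    by (simp add: lessThan_7 p phi_simps)
  also have "\<dots> = 1 + chi u + chi v + chi (u - v)"
    unfolding chi_mult by (simp add: u_def v_def algebra_simps)
  also have "\<dots> = (if (u, v) = 0 then 4 else if (u, v) \<in> connection_set then 2 else 0)"
    using cases_4[of u] cases_4[of v] by (elim disjE) (simp_all add: chi_def connection_set_def zero_prod_def)
  also have "(u, v) = q - p" by (simp add: p u_def v_def)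
  finally show ?thesis by auto
qed

lemma UNIV_44: "(UNIV :: (4 \<times> 4) set) = {0,1,2,3} \<times> {0,1,2,3}"
  using UNIV_4 by (metis UNIV_Times_UNIV)

text \<open>Orthogonality of characters on a group of order 16; the square of a cosine or sine part
  has mean 1/2, hence the norm 8.\<close>

lemma phi_orth:
  assumes "a < 7" "b < 7"
  shows "(\<Sum>p\<in>UNIV. phi a p * phi b p) = (if a = b then if a = 0 then 16 else 8 else 0)"
proof -
  have "a \<in> {0,1,2,3,4,5,6}" "b \<in> {0,1,2,3,4,5,6}" using assms by auto
  then show ?thesis
    by (elim insertE emptyE; simp add: UNIV_44 sum.cartesian_product[symmetric] phi_def chi_def)
qed

text \<open>The four parity checks define the Hamming code of length 7, whose minimum weight is 3.\<close>

lemma hamming_code_weight: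
  fixes c p0 p1 q0 q1 r0 r1 :: int
  assumes "even (c + p0 + q0 + r0)" "even (c + p1 + q1 + r0)"
    and "even (c + p0 + q1 + r1)" "even (c + p1 + q0 + r1)"
  defines "m \<equiv> c\<^sup>2 + p0\<^sup>2 + p1\<^sup>2 + q0\<^sup>2 + q1\<^sup>2 + r0\<^sup>2 + r1\<^sup>2"
  shows "m = 0 \<or> m \<ge> 3"
proof (rule ccontr)
  assume neg: "\<not> ?thesis"
  \<comment> \<open>A total below 3 confines every entry to -1, 0, 1, where the square depends only
    on the parity. Five parities are then split; the checks determine those of \<open>r0\<close> and
    \<open>r1\<close>.\<close>
  have sq: "v\<^sup>2 = of_bool (odd v)" if "v\<^sup>2 < 3" for v :: int
  proof -
    have "\<bar>v\<bar> < 2"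
    proof (rule ccontr)
      assume "\<not> \<bar>v\<bar> < 2"
      then have "2\<^sup>2 \<le> \<bar>v\<bar>\<^sup>2" by (intro power_mono) auto
      then show False using that by simp
    qed
    then have "v = -1 \<or> v = 0 \<or> v = 1" by auto
    then show ?thesis by auto
  qed
  have nonneg: "c\<^sup>2 \<ge> 0" "p0\<^sup>2 \<ge> 0" "p1\<^sup>2 \<ge> 0" "q0\<^sup>2 \<ge> 0" "q1\<^sup>2 \<ge> 0" "r0\<^sup>2 \<ge> 0" "r1\<^sup>2 \<ge> 0"
    by simp_all
  then have small: "c\<^sup>2 < 3" "p0\<^sup>2 < 3" "p1\<^sup>2 < 3" "q0\<^sup>2 < 3" "q1\<^sup>2 < 3" "r0\<^sup>2 < 3" "r1\<^sup>2 < 3"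
    using neg unfolding m_def by linarith+
  have "m = of_bool (odd c) + of_bool (odd p0) + of_bool (odd p1) + of_bool (odd q0) +
      of_bool (odd q1) + of_bool (odd r0) + of_bool (odd r1)"
    unfolding m_def by (simp only: small[THEN sq])
  moreover have "m < 3" "m \<noteq> 0" using neg by auto
  ultimately show False
    using assms(1-4)
    by (cases "odd c"; cases "odd p0"; cases "odd p1"; cases "odd q0"; cases "odd q1"; simp)
qed

text \<open>Each coefficient is an integral combination of values of \<open>f\<close>, and
  \<open>2 * f\<close> at four points expresses the parity checks of the Hamming code.\<close>

lemma phi_coefficients:
  fixes w :: "nat \<Rightarrow> real" and f :: "4 \<times> 4 \<Rightarrow> int"
  assumes f: "\<And>p. 2 * real_of_int (f p) = (\<Sum>a<7. real_of_int (phi a p) * w a)"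
  obtains k :: int where "(\<Sum>a<7. (w a)\<^sup>2) = of_int k" "k = 0 \<or> k \<ge> 3"
proof -
  have f': "2 * real_of_int (f (x, y)) =
      w 0 + chi x * w 1 + chi (x - 1) * w 2 + chi y * w 3 + chi (y - 1) * w 4 +
      chi (x - y) * w 5 + chi (x - y - 1) * w 6" for x y
    unfolding f by (simp add: lessThan_7 phi_simps)
  note vals = f'[of 0 0] f'[of 1 1] f'[of 0 1] f'[of 1 0] f'[of 3 0] f'[of 2 1] f'[of 0 3]
    f'[of 1 2] f'[of 2 0]
  \<comment> \<open>In each of these six signed sums of four values all coefficients but one cancel
    in \<open>2 * f\<close>, and the surviving one occurs twice; the constant coefficient is then
    read off at (0,0).\<close>
  define r0 where "r0 = f (0,0) + f (1,1) - f (0,1) - f (1,0)"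
  define p0 where "p0 = f (0,0) + f (0,1) - f (3,0) - f (1,1)"
  define p1 where "p1 = f (1,0) + f (1,1) - f (0,0) - f (2,1)"
  define q0 where "q0 = f (0,0) + f (1,0) - f (1,1) - f (0,3)"
  define q1 where "q1 = f (0,1) + f (1,1) - f (0,0) - f (1,2)"
  define r1 where "r1 = f (1,0) + f (2,1) - f (1,1) - f (2,0)"
  define c where "c = 2 * f (0,0) - p0 - q0 - r0"
  note defs = c_def p0_def p1_def q0_def q1_def r0_def r1_def
  have w: "w 1 = p0" "w 2 = p1" "w 3 = q0" "w 4 = q1" "w 5 = r0" "w 6 = r1" "w 0 = c"
    using vals by (simp_all add: defs chi_def)
  have "real_of_int (2 * f (0,0)) = of_int (c + p0 + q0 + r0)"
    "real_of_int (2 * f (1,1)) = of_int (c + p1 + q1 + r0)"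
    "real_of_int (2 * f (0,1)) = of_int (c + p0 + q1 - r1)"
    "real_of_int (2 * f (1,0)) = of_int (c + p1 + q0 + r1)"
    using vals by (simp_all add: chi_def w[symmetric])
  \<comment> \<open>The value at (0,1) contains \<open>- r1\<close>; adding \<open>2 * r1\<close>
    turns it into the form of the third parity check.\<close>
  then have "c + p0 + q0 + r0 = 2 * f (0,0)" "c + p1 + q1 + r0 = 2 * f (1,1)"
    "c + p0 + q1 + r1 = 2 * (f (0,1) + r1)" "c + p1 + q0 + r1 = 2 * f (1,0)"
    unfolding of_int_eq_iff by simp_all
  then have "even (c + p0 + q0 + r0)" "even (c + p1 + q1 + r0)"
     "even (c + p0 + q1 + r1)" "even (c + p1 + q0 + r1)"
    by (metis dvd_triv_left)+
  from hamming_code_weight[OF this] show thesis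
    by (intro that[of "c\<^sup>2 + p0\<^sup>2 + p1\<^sup>2 + q0\<^sup>2 + q1\<^sup>2 + r0\<^sup>2 + r1\<^sup>2"])
      (simp_all add: lessThan_7 w[unfolded One_nat_def])
qed

subsection \<open>Orthonormal systems\<close>

text \<open>Equal Gram matrices make \<open>d\<close> an isometric image of the columns of the
  matrix \<open>phi\<close>. As the rows of this matrix are orthogonal, the combination defining
  \<open>u a\<close> is the image of the \<open>a\<close>-th unit vector.\<close>

lemma orthonormal_decomposition:
  fixes phi :: "'a \<Rightarrow> 'x::finite \<Rightarrow> real" and d :: "'x \<Rightarrow> 'i \<Rightarrow> real" and n :: "'a \<Rightarrow> real"
  assumes fin: "finite B" "finite I"
    and n: "\<And>a. a \<in> B \<Longrightarrow> n a > 0"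
    and orth: "\<And>a b. a \<in> B \<Longrightarrow> b \<in> B \<Longrightarrow> (\<Sum>x\<in>UNIV. phi a x * phi b x) = (if a = b then n a else 0)"
    and gram: "\<And>x y. (\<Sum>i\<in>I. d x i * d y i) = (\<Sum>a\<in>B. phi a x * phi a y)"
  defines "u \<equiv> \<lambda>a i. (\<Sum>x\<in>UNIV. phi a x * d x i) / n a"
  shows "a \<in> B \<Longrightarrow> b \<in> B \<Longrightarrow> (\<Sum>i\<in>I. u a i * u b i) = (if a = b then 1 else 0)"
    and "i \<in> I \<Longrightarrow> d x i = (\<Sum>a\<in>B. phi a x * u a i)"
proof -
  have du: "(\<Sum>i\<in>I. d x i * u a i) = phi a x" if a: "a \<in> B" for a x
  proof -
    have "(\<Sum>i\<in>I. d x i * u a i) = (\<Sum>i\<in>I. \<Sum>y\<in>UNIV. phi a y * (d x i * d y i)) / n a"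
      by (simp add: u_def sum_divide_distrib sum_distrib_left mult_ac)
    also have "\<dots> = (\<Sum>y\<in>UNIV. phi a y * (\<Sum>i\<in>I. d x i * d y i)) / n a"
      by (subst sum.swap) (simp add: sum_distrib_left)
    also have "\<dots> = (\<Sum>y\<in>UNIV. \<Sum>b\<in>B. phi b x * (phi a y * phi b y)) / n a"
      by (simp add: gram sum_distrib_left mult_ac)
    also have "\<dots> = (\<Sum>b\<in>B. phi b x * (\<Sum>y\<in>UNIV. phi a y * phi b y)) / n a"
      by (subst sum.swap) (simp add: sum_distrib_left)
    also have "\<dots> = (\<Sum>b\<in>B. if a = b then phi b x * n a else 0) / n a"
      using a by (intro arg_cong2[where f = "(/)"] sum.cong) (simp_all add: orth)
    also have "\<dots> = phi a x"
      using n[OF a] a fin by simp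
    finally show ?thesis .
  qed
  show orthonormal: "(\<Sum>i\<in>I. u a i * u b i) = (if a = b then 1 else 0)" if a: "a \<in> B" and b: "b \<in> B" for a b
  proof -
    have ua: "u a = (\<lambda>i. (\<Sum>x\<in>UNIV. phi a x * d x i) / n a)" by (simp add: u_def)
    have "(\<Sum>i\<in>I. u a i * u b i) = (\<Sum>i\<in>I. \<Sum>x\<in>UNIV. phi a x * (d x i * u b i)) / n a"
      unfolding ua sum_divide_distrib sum_distrib_right by (simp add: mult_ac)
    also have "\<dots> = (\<Sum>x\<in>UNIV. phi a x * (\<Sum>i\<in>I. d x i * u b i)) / n a"
      by (subst sum.swap) (simp add: sum_distrib_left)
    also have "\<dots> = (if a = b then 1 else 0)"
      using n[OF a] by (auto simp: du b orth[OF a b])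
    finally show ?thesis .
  qed
  show "d x i = (\<Sum>a\<in>B. phi a x * u a i)" if i: "i \<in> I" for x i
  proof -
    \<comment> \<open>The vectors \<open>d x\<close> and \<open>?e\<close> have the same squared
      norm, which is also their inner product; so their difference has norm 0.\<close>
    let ?e = "\<lambda>i. \<Sum>a\<in>B. phi a x * u a i"
    have 1: "(\<Sum>i\<in>I. d x i * ?e i) = (\<Sum>a\<in>B. phi a x * phi a x)"
    proof -
      have "(\<Sum>i\<in>I. d x i * ?e i) = (\<Sum>a\<in>B. \<Sum>i\<in>I. phi a x * (d x i * u a i))"
        by (subst sum.swap) (simp add: sum_distrib_left mult_ac)
      then show ?thesis by (simp add: sum_distrib_left[symmetric] du)
    qed
    have 2: "(\<Sum>i\<in>I. ?e i * ?e i) = (\<Sum>a\<in>B. phi a x * phi a x)"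
    proof -
      have "(\<Sum>i\<in>I. ?e i * ?e i) = (\<Sum>i\<in>I. \<Sum>a\<in>B. \<Sum>b\<in>B. phi a x * phi b x * (u a i * u b i))"
        by (simp add: sum_product mult_ac)
      also have "\<dots> = (\<Sum>a\<in>B. \<Sum>i\<in>I. \<Sum>b\<in>B. phi a x * phi b x * (u a i * u b i))"
        by (rule sum.swap)
      also have "\<dots> = (\<Sum>a\<in>B. \<Sum>b\<in>B. phi a x * phi b x * (\<Sum>i\<in>I. u a i * u b i))"
        by (intro sum.cong refl, subst sum.swap) (simp add: sum_distrib_left)
      also have "\<dots> = (\<Sum>a\<in>B. \<Sum>b\<in>B. if a = b then phi a x * phi b x else 0)"
        by (intro sum.cong refl) (simp add: orthonormal)
      finally show ?thesis using fin by simp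
    qed
    have "(\<Sum>i\<in>I. (d x i - ?e i)\<^sup>2) = (\<Sum>i\<in>I. d x i * d x i) - 2 * (\<Sum>i\<in>I. d x i * ?e i) + (\<Sum>i\<in>I. ?e i * ?e i)"
      unfolding sum_distrib_left[of 2] sum_subtractf[symmetric] sum.distrib[symmetric]
      by (intro sum.cong refl) (simp add: power2_eq_square algebra_simps)
    also have "\<dots> = 0" using 1 2 gram[of x x] by simp
    finally have "(d x i - ?e i)\<^sup>2 = 0" using i fin
      by (subst (asm) sum_nonneg_eq_0_iff) auto
    then show ?thesis by simp
  qed
qed

text \<open>Bessel's inequality for the \<open>i\<close>-th unit vector. In the case of equality
  this vector lies in the span of the \<open>u a\<close>, so a vector orthogonal to all of them
  vanishes at \<open>i\<close>.\<close>

lemma orthonormal_row_bound: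
  fixes u :: "'a \<Rightarrow> 'i \<Rightarrow> real"
  assumes fin: "finite B" "finite I"
    and orthonormal: "\<And>a b. a \<in> B \<Longrightarrow> b \<in> B \<Longrightarrow> (\<Sum>i\<in>I. u a i * u b i) = (if a = b then 1 else 0)"
    and i: "i \<in> I"
  shows "(\<Sum>a\<in>B. (u a i)\<^sup>2) \<le> 1"
    and "(\<Sum>a\<in>B. (u a i)\<^sup>2) = 1 \<Longrightarrow> (\<And>a. a \<in> B \<Longrightarrow> (\<Sum>j\<in>I. s j * u a j) = 0) \<Longrightarrow> s i = 0"
proof -
  \<comment> \<open>The orthogonal projection of the \<open>i\<close>-th unit vector onto the span;
    its squared norm and its \<open>i\<close>-th coordinate agree.\<close>
  define z where "z j = (\<Sum>a\<in>B. u a i * u a j)" for j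
  define m where "m = (\<Sum>a\<in>B. (u a i)\<^sup>2)"
  have zi: "z i = m" by (simp add: z_def m_def power2_eq_square)
  have "(\<Sum>j\<in>I. (z j)\<^sup>2) = (\<Sum>j\<in>I. \<Sum>a\<in>B. \<Sum>b\<in>B. u a i * u b i * (u a j * u b j))"
    by (simp add: z_def power2_eq_square sum_product mult_ac)
  also have "\<dots> = (\<Sum>a\<in>B. \<Sum>j\<in>I. \<Sum>b\<in>B. u a i * u b i * (u a j * u b j))"
    by (rule sum.swap)
  also have "\<dots> = (\<Sum>a\<in>B. \<Sum>b\<in>B. u a i * u b i * (\<Sum>j\<in>I. u a j * u b j))"
    by (intro sum.cong refl, subst sum.swap) (simp add: sum_distrib_left)
  also have "\<dots> = (\<Sum>a\<in>B. \<Sum>b\<in>B. if a = b then u a i * u b i else 0)"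
    by (intro sum.cong refl) (simp add: orthonormal)
  finally have zz: "(\<Sum>j\<in>I. (z j)\<^sup>2) = m" using fin by (simp add: m_def power2_eq_square)
  have split: "m = m\<^sup>2 + (\<Sum>j\<in>I - {i}. (z j)\<^sup>2)"
    using zz zi sum.remove[OF fin(2) i, of "\<lambda>j. (z j)\<^sup>2"] by simp
  have nn: "(\<Sum>j\<in>I - {i}. (z j)\<^sup>2) \<ge> 0" by (simp add: sum_nonneg)
  show "(\<Sum>a\<in>B. (u a i)\<^sup>2) \<le> 1"
  proof (rule ccontr)
    assume "\<not> ?thesis"
    then have "m * 1 < m * m" by (intro mult_strict_left_mono) (auto simp: m_def)
    then show False using split nn by (simp add: power2_eq_square)
  qed
  assume "(\<Sum>a\<in>B. (u a i)\<^sup>2) = 1" and s: "\<And>a. a \<in> B \<Longrightarrow> (\<Sum>j\<in>I. s j * u a j) = 0"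
  then have m: "m = 1" by (simp add: m_def)
  have z0: "z j = 0" if "j \<in> I - {i}" for j
    using split m that fin sum_nonneg_eq_0_iff[of "I - {i}" "\<lambda>j. (z j)\<^sup>2"] by auto
  have "(\<Sum>j\<in>I. s j * z j) = (\<Sum>a\<in>B. u a i * (\<Sum>j\<in>I. s j * u a j))"
    unfolding z_def sum_distrib_left by (subst sum.swap) (simp add: mult_ac)
  also have "\<dots> = 0" using s by simp
  finally have "s i * z i + (\<Sum>j\<in>I - {i}. s j * z j) = 0"
    using sum.remove[OF fin(2) i, of "\<lambda>j. s j * z j"] by simp
  then show "s i = 0" using z0 zi m by simp
qed

section \<open>Two layers have no integral representation\<close>

text \<open>The hypotheses are the Gram matrix that A + 3I prescribes on two layers of the product:
  3I + A within a layer and I across.\<close>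

lemma no_integral_shrikhande_layers:
  fixes X Y :: "4 \<times> 4 \<Rightarrow> 'i \<Rightarrow> int"
  assumes fin: "finite I"
    and XX: "\<And>p q. (\<Sum>i\<in>I. X p i * X q i) = (if p = q then 3 else if q - p \<in> connection_set then 1 else 0)"
    and YY: "\<And>p q. (\<Sum>i\<in>I. Y p i * Y q i) = (if p = q then 3 else if q - p \<in> connection_set then 1 else 0)"
    and XY: "\<And>p q. (\<Sum>i\<in>I. X p i * Y q i) = (if p = q then 1 else 0)"
  shows False
proof -
  define d where "d p i = real_of_int (X p i - Y p i)" for p i
  define s where "s p i = real_of_int (X p i + Y p i)" for p i
  define ph where "ph a p = real_of_int (phi a p)" for a p
  define n :: "nat \<Rightarrow> real" where "n a = (if a = 0 then 16 else 8)" for a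
  \<comment> \<open>Normalized to length 1; the vectors w of the overview are
    \<open>2 * u a\<close>, which explains the factor 4 in \<open>m\<close> below.\<close>
  define u where "u a i = (\<Sum>p\<in>UNIV. ph a p * d p i) / n a" for a i
  have YX: "(\<Sum>i\<in>I. Y p i * X q i) = (if p = q then 1 else 0)" for p q
    using XY[of q p] by (simp add: mult.commute[of "Y p _"] eq_commute[of p q])
  have dd: "(\<Sum>i\<in>I. d p i * d q i) = (\<Sum>a<7. ph a p * ph a q)" for p q
  proof -
    have "(\<Sum>i\<in>I. (X p i - Y p i) * (X q i - Y q i)) = (\<Sum>i\<in>I. X p i * X q i) -
        (\<Sum>i\<in>I. X p i * Y q i) - (\<Sum>i\<in>I. Y p i * X q i) + (\<Sum>i\<in>I. Y p i * Y q i)"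
      by (simp add: algebra_simps sum.distrib sum_subtractf)
    also have "\<dots> = (\<Sum>a<7. phi a p * phi a q)"
      unfolding XX YY XY YX phi_sum by (cases "p = q") simp_all
    finally have "real_of_int (\<Sum>i\<in>I. (X p i - Y p i) * (X q i - Y q i)) = of_int (\<Sum>a<7. phi a p * phi a q)"
      by simp
    then show ?thesis by (simp add: d_def ph_def)
  qed
  have sd: "(\<Sum>i\<in>I. s p i * d q i) = 0" for p q
  proof -
    have "(\<Sum>i\<in>I. (X p i + Y p i) * (X q i - Y q i)) = (\<Sum>i\<in>I. X p i * X q i) -
        (\<Sum>i\<in>I. X p i * Y q i) + (\<Sum>i\<in>I. Y p i * X q i) - (\<Sum>i\<in>I. Y p i * Y q i)"
      by (simp add: algebra_simps sum.distrib sum_subtractf)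
    also have "\<dots> = 0"
      unfolding XX YY XY YX by (cases "p = q") simp_all
    finally have "real_of_int (\<Sum>i\<in>I. (X p i + Y p i) * (X q i - Y q i)) = 0"
      by simp
    then show ?thesis by (simp add: d_def s_def)
  qed
  have orth: "(\<Sum>p\<in>UNIV. ph a p * ph b p) = (if a = b then n a else 0)" if "a < 7" "b < 7" for a b
  proof -
    have "(\<Sum>p\<in>UNIV. ph a p * ph b p) = of_int (\<Sum>p\<in>UNIV. phi a p * phi b p)"
      by (simp add: ph_def)
    then show ?thesis unfolding phi_orth[OF that] by (simp add: n_def)
  qed
  have uu: "(\<Sum>i\<in>I. u a i * u b i) = (if a = b then 1 else 0)" if "a \<in> {..<7}" "b \<in> {..<7}" for a b
    unfolding u_def
    by (rule orthonormal_decomposition(1)[of "{..<7}" I n ph d]) (use that in \<open>simp_all add: fin dd orth n_def\<close>)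
  have du: "d p i = (\<Sum>a<7. ph a p * u a i)" if "i \<in> I" for p i
    unfolding u_def
    by (rule orthonormal_decomposition(2)[of "{..<7}" I n ph d]) (use that in \<open>simp_all add: fin dd orth n_def\<close>)
  have su: "(\<Sum>i\<in>I. s p i * u a i) = 0" for p a
  proof -
    have "(\<Sum>i\<in>I. s p i * u a i) = (\<Sum>i\<in>I. \<Sum>q\<in>UNIV. ph a q * (s p i * d q i)) / n a"
      unfolding u_def sum_divide_distrib sum_distrib_left by (simp add: mult_ac)
    also have "\<dots> = (\<Sum>q\<in>UNIV. ph a q * (\<Sum>i\<in>I. s p i * d q i)) / n a"
      by (subst sum.swap) (simp add: sum_distrib_left)
    finally show ?thesis by (simp add: sd)
  qed
  define m where "m i = 4 * (\<Sum>a<7. (u a i)\<^sup>2)" for i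
  have m: "m i = 0 \<or> m i = 3" if i: "i \<in> I" for i
  proof -
    have le: "m i \<le> 4"
      using orthonormal_row_bound(1)[OF finite_lessThan fin uu i] by (simp add: m_def)
    obtain k :: int where k: "(\<Sum>a<7. (2 * u a i)\<^sup>2) = of_int k" "k = 0 \<or> k \<ge> 3"
    proof (rule phi_coefficients)
      show "2 * real_of_int (X p i - Y p i) = (\<Sum>a<7. real_of_int (phi a p) * (2 * u a i))" for p
        using du[OF i, of p] by (simp add: d_def ph_def sum_distrib_left mult_ac)
    qed
    have mk: "m i = of_int k"
      using k(1) by (simp add: m_def power_mult_distrib sum_distrib_left)
    have "k \<noteq> 4"
    proof
      assume "k = 4"
      then have one: "(\<Sum>a<7. (u a i)\<^sup>2) = 1" using mk by (simp add: m_def)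
      have "s p i = 0" for p
        by (rule orthonormal_row_bound(2)[OF finite_lessThan fin uu i one su])
      then have "X p i = - Y p i" for p
        unfolding s_def of_int_eq_0_iff by (simp add: eq_neg_iff_add_eq_0)
      then have d: "d p i = 2 * of_int (X p i)" for p
        by (simp add: d_def)
      \<comment> \<open>With \<open>d\<close> even, the parity argument applies to \<open>u\<close>
        without doubling, and the total 1 is not an admissible weight.\<close>
      obtain k' :: int where "(\<Sum>a<7. (u a i)\<^sup>2) = of_int k'" "k' = 0 \<or> k' \<ge> 3"
      proof (rule phi_coefficients)
        show "2 * real_of_int (X p i) = (\<Sum>a<7. real_of_int (phi a p) * u a i)" for p
          using du[OF i, of p] by (simp add: d ph_def)
      qed
      then show False using one by linarith
    qed
    then show ?thesis using k(2) le mk by linarith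
  qed
  have "(\<Sum>i\<in>I. m i) = 4 * (\<Sum>a<7. \<Sum>i\<in>I. u a i * u a i)"
    unfolding m_def sum_distrib_left power2_eq_square by (rule sum.swap)
  also have "\<dots> = 28" by (simp add: uu)
  finally have "(\<Sum>i\<in>I. m i) = 28" .
  moreover have "(\<Sum>i\<in>I. m i) = (\<Sum>i\<in>I. if m i = 3 then 3 else 0)"
    using m by (intro sum.cong refl) auto
  moreover have "\<dots> = 3 * real (card {i\<in>I. m i = 3})"
    using fin by (simp add: sum.If_cases Int_def)
  ultimately have "real (3 * card {i\<in>I. m i = 3}) = real 28" by simp
  then have "3 * card {i\<in>I. m i = 3} = 28" unfolding of_nat_eq_iff .
  then show False by presburger
qed

subsection \<open>Distance, spectrum and integrability of finite graphs\<close>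

text \<open>With unit weights the cost of a walk is its length, so distance 2 rules out walks of
  length 0 and 1. Without a walk of length 2 every walk would have length at least 3, and so would
  the infimum.\<close>

lemma graph_dist_eq_2D:
  assumes "pair_wf_digraph G" and x: "x \<in> pverts G" and y: "y \<in> pverts G"
    and dist: "graph_dist G x y = 2"
  shows "x \<noteq> y" and "(x, y) \<notin> parcs G" and "\<exists>z. (x, z) \<in> parcs G \<and> (z, y) \<in> parcs G"
proof -
  interpret pair_wf_digraph G by fact
  have cost: "awalk_cost (\<lambda>_. 1) p = real (length p)" for p
    by (induction p) (simp_all add: awalk_cost_def)
  have mu: "\<mu> (\<lambda>_. 1) x y = 2" using dist by (simp add: graph_dist_def)
  have lower: "2 \<le> length p" if "awalk x p y" for p
  proof -
    have "ereal 2 \<le> ereal (real (length p))"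
      using min_cost_le_walk_cost[OF that, of "\<lambda>_. 1"] mu by (simp add: cost)
    then show ?thesis by simp
  qed
  show "x \<noteq> y" using lower[of "[]"] x by (auto simp: awalk_def)
  show "(x, y) \<notin> parcs G" using lower[of "[(x, y)]"] x by (auto simp: awalk_def)
  show "\<exists>z. (x, z) \<in> parcs G \<and> (z, y) \<in> parcs G"
  proof (rule ccontr)
    assume none: "\<not> ?thesis"
    have "3 \<le> length p" if p: "awalk x p y" for p
    proof (rule ccontr)
      assume "\<not> 3 \<le> length p"
      then have "length p = 2" using lower[OF p] by simp
      then obtain e f where "p = [e, f]" by (auto simp: length_Suc_conv numeral_2_eq_2)
      then show False using p none by (cases e; cases f) (auto simp: awalk_def)
    qed
    then have "ereal 3 \<le> \<mu> (\<lambda>_. 1) x y"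
      unfolding \<mu>_def by (intro INF_greatest) (simp add: cost)
    then show False using mu by simp
  qed
qed

lemma vertex_list:
  assumes "finite (pverts G)"
  shows "distinct (vertex_list G)" and "set (vertex_list G) = pverts G"
    and "length (vertex_list G) = card (pverts G)"
proof -
  have "\<exists>xs. distinct xs \<and> set xs = pverts G"
    using finite_distinct_list[OF assms] by blast
  from someI_ex[OF this] show *: "distinct (vertex_list G)" "set (vertex_list G) = pverts G"
    unfolding vertex_list_def by auto
  then show "length (vertex_list G) = card (pverts G)"
    using distinct_card by metis
qed

lemma bij_betw_vertex_list:
  assumes "finite (pverts G)"
  shows "bij_betw ((!) (vertex_list G)) {0..<card (pverts G)} (pverts G)"
  using vertex_list[OF assms] bij_betw_nth[of "vertex_list G"] by (simp add: atLeast0LessThan)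

text \<open>Passing from vectors to functions on the vertices removes the arbitrary vertex order
  from all spectral arguments.\<close>

lemma eigenvalue_adjacency_matrix_iff:
  assumes fin: "finite (pverts G)"
  shows "eigenvalue (adjacency_matrix G) k \<longleftrightarrow>
    (\<exists>f. (\<exists>x\<in>pverts G. f x \<noteq> 0) \<and>
      (\<forall>x\<in>pverts G. (\<Sum>y\<in>pverts G. of_bool ((x, y) \<in> parcs G) * f y) = k * f x))"
    (is "?L \<longleftrightarrow> ?R")
proof -
  let ?n = "card (pverts G)" and ?v = "\<lambda>i. vertex_list G ! i"
  note bij = bij_betw_vertex_list[OF fin]
  have V: "?v j \<in> pverts G" if "j < ?n" for j
    using bij_betwE[OF bij] that by simp
  have V': "\<exists>i<?n. x = ?v i" if "x \<in> pverts G" for x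
    using that bij_betw_imp_surj_on[OF bij] by (metis atLeastLessThan_iff imageE)
  have mult: "(adjacency_matrix G *\<^sub>v v) $ i = (\<Sum>y\<in>pverts G. of_bool ((?v i, y) \<in> parcs G) * f y)"
    if "v \<in> carrier_vec ?n" "i < ?n" "\<And>j. j < ?n \<Longrightarrow> v $ j = f (?v j)" for v f i
  proof -
    have "(adjacency_matrix G *\<^sub>v v) $ i = (\<Sum>j = 0..<?n. of_bool ((?v i, ?v j) \<in> parcs G) * v $ j)"
      using that(1,2) by (simp add: adjacency_matrix_def scalar_prod_def of_bool_def)
    also have "\<dots> = (\<Sum>j = 0..<?n. of_bool ((?v i, ?v j) \<in> parcs G) * f (?v j))"
      using that(3) by (intro sum.cong) auto
    also have "\<dots> = (\<Sum>y\<in>pverts G. of_bool ((?v i, y) \<in> parcs G) * f y)"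
      by (rule sum.reindex_bij_betw[OF bij])
    finally show ?thesis .
  qed
  have dim: "dim_row (adjacency_matrix G) = ?n" by (simp add: adjacency_matrix_def)
  show ?thesis
  proof
    assume ?L
    then obtain v where v: "v \<in> carrier_vec ?n" "v \<noteq> 0\<^sub>v ?n" "adjacency_matrix G *\<^sub>v v = k \<cdot>\<^sub>v v"
      unfolding eigenvalue_def eigenvector_def dim by auto
    define f where "f x = v $ (the_inv_into {0..<?n} ?v x)" for x
    have vf: "v $ j = f (?v j)" if "j < ?n" for j
      using the_inv_into_f_f[OF bij_betw_imp_inj_on[OF bij], of j] that by (simp add: f_def)
    have "\<exists>j<?n. v $ j \<noteq> 0" using v(1,2) by (auto simp: vec_eq_iff)
    then have "\<exists>x\<in>pverts G. f x \<noteq> 0" using vf V by auto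
    moreover have "(\<Sum>y\<in>pverts G. of_bool ((x, y) \<in> parcs G) * f y) = k * f x" if "x \<in> pverts G" for x
    proof -
      obtain i where i: "i < ?n" "x = ?v i" using V'[OF \<open>x \<in> pverts G\<close>] by blast
      show ?thesis using mult[OF v(1) i(1) vf] v(1,3) i vf[OF i(1)] by simp
    qed
    ultimately show ?R by blast
  next
    assume ?R
    then obtain f x where x: "x \<in> pverts G" "f x \<noteq> 0"
      and f: "\<And>x. x \<in> pverts G \<Longrightarrow> (\<Sum>y\<in>pverts G. of_bool ((x, y) \<in> parcs G) * f y) = k * f x"
      by blast
    define v where "v = vec ?n (\<lambda>j. f (?v j))"
    have v: "v \<in> carrier_vec ?n" "\<And>j. j < ?n \<Longrightarrow> v $ j = f (?v j)" by (simp_all add: v_def)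
    obtain i where i: "i < ?n" "x = ?v i" using V' x by blast
    then have "v \<noteq> 0\<^sub>v ?n" using v x by (metis index_zero_vec(1))
    moreover have "adjacency_matrix G *\<^sub>v v = k \<cdot>\<^sub>v v"
    proof (rule eq_vecI)
      show "dim_vec (adjacency_matrix G *\<^sub>v v) = dim_vec (k \<cdot>\<^sub>v v)" using v dim by simp
      fix j assume "j < dim_vec (k \<cdot>\<^sub>v v)"
      then have j: "j < ?n" using v by simp
      then have "?v j \<in> pverts G" by (rule V)
      then show "(adjacency_matrix G *\<^sub>v v) $ j = (k \<cdot>\<^sub>v v) $ j"
        using mult[OF v(1) j v(2)] f j v by simp
    qed
    ultimately show ?L unfolding eigenvalue_def eigenvector_def dim using v by blast
  qed
qed

text \<open>Finiteness is what gives \<open>Min\<close> in \<open>lambda_min\<close> its meaning;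
  the eigenvalues are roots of a monic polynomial.\<close>

lemma finite_eigenvalues_adjacency_matrix: "finite {k. eigenvalue (adjacency_matrix G) k}"
proof -
  have A: "adjacency_matrix G \<in> carrier_mat (card (pverts G)) (card (pverts G))"
    by (simp add: adjacency_matrix_def)
  have "char_poly (adjacency_matrix G) \<noteq> 0"
    using degree_monic_char_poly[OF A] by auto
  then show ?thesis
    unfolding eigenvalue_root_char_poly[OF A] by (rule poly_roots_finite)
qed

text \<open>The columns of the integral matrix, relabelled by the vertices, are the representing
  vectors.\<close>

lemma one_integrable_gram:
  assumes fin: "finite (pverts G)" and "s_integrable 1 G"
  obtains m :: nat and F :: "'a \<Rightarrow> nat \<Rightarrow> int" where
    "\<And>x y. x \<in> pverts G \<Longrightarrow> y \<in> pverts G \<Longrightarrow>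
      (\<Sum>r<m. F x r * F y r) = of_bool ((x, y) \<in> parcs G) + (if x = y then \<lceil>- lambda_min G\<rceil> else 0)"
proof -
  let ?n = "card (pverts G)" and ?v = "\<lambda>i. vertex_list G ! i" and ?c = "\<lceil>- lambda_min G\<rceil>"
  note bij = bij_betw_vertex_list[OF fin]
  obtain m N where N: "N \<in> carrier_mat m ?n"
    and eq: "adjacency_matrix G + of_int ?c \<cdot>\<^sub>m 1\<^sub>m ?n = (1 / of_nat 1) \<cdot>\<^sub>m map_mat real_of_int (N\<^sup>T * N)"
    using assms(2) unfolding s_integrable_def by blast
  define idx where "idx = the_inv_into {0..<?n} ?v"
  have idx: "idx x < ?n" "?v (idx x) = x" if "x \<in> pverts G" for x
    using bij_betwE[OF bij_betw_the_inv_into[OF bij]] that f_the_inv_into_f_bij_betw[OF bij, of x]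
    by (auto simp: idx_def)
  show thesis
  proof (rule that[of "\<lambda>x r. N $$ (r, idx x)" m])
    fix x y assume xy: "x \<in> pverts G" "y \<in> pverts G"
    have "(N\<^sup>T * N) $$ (idx x, idx y) = (\<Sum>r<m. N $$ (r, idx x) * N $$ (r, idx y))"
      using N idx xy by (simp add: scalar_prod_def atLeast0LessThan)
    moreover have "real_of_int ((N\<^sup>T * N) $$ (idx x, idx y)) =
        (adjacency_matrix G + of_int ?c \<cdot>\<^sub>m 1\<^sub>m ?n) $$ (idx x, idx y)"
      unfolding eq using N idx xy by simp
    moreover have "\<dots> = of_int (of_bool ((x, y) \<in> parcs G) + (if x = y then ?c else 0))"
      using idx(1)[OF xy(1)] idx(1)[OF xy(2)] idx(2)[OF xy(1)] idx(2)[OF xy(2)]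
      by (cases "x = y") (auto simp: adjacency_matrix_def)
    ultimately show "(\<Sum>r<m. N $$ (r, idx x) * N $$ (r, idx y)) =
        of_bool ((x, y) \<in> parcs G) + (if x = y then ?c else 0)"
      by linarith
  qed
qed

subsection \<open>The products with complete graphs\<close>

abbreviation shrikhande_prism :: "nat \<Rightarrow> ((4 \<times> 4) \<times> nat) pair_pre_digraph" where
  "shrikhande_prism t \<equiv> shrikhande_graph \<box> complete_graph t"

lemma pverts_prism: "pverts (shrikhande_prism t) = UNIV \<times> {..<t}"
  by (simp add: cartesian_product_def shrikhande_graph_def cayley_graph_def complete_graph_def)

lemma parcs_prism:
  "((p, i), (q, j)) \<in> parcs (shrikhande_prism t) \<longleftrightarrow>
     i < t \<and> j < t \<and> (p = q \<and> i \<noteq> j \<or> i = j \<and> q - p \<in> connection_set)"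
proof -
  have "(p, q) \<in> parcs shrikhande_graph \<longleftrightarrow> q - p \<in> connection_set" "p \<in> pverts shrikhande_graph" for p q
    by (simp_all add: shrikhande_graph_def cayley_graph_def connection_set_def)
  then show ?thesis by (auto simp: cartesian_product_def complete_graph_def)
qed

section \<open>Sesqui-regularity\<close>

lemma uminus_in_connection_set: "- p \<in> connection_set \<longleftrightarrow> p \<in> connection_set"
  using cases_4[of "fst p"] cases_4[of "snd p"]
  by (cases p) (elim disjE; simp add: connection_set_def)

lemma diff_in_connection_set_commute: "q - p \<in> connection_set \<longleftrightarrow> p - q \<in> connection_set"
  using uminus_in_connection_set[of "p - q"] by simp

lemma zero_notin_connection_set: "0 \<notin> connection_set"
  by (simp add: connection_set_def zero_prod_def)

lemma card_connection_set: "card connection_set = 6"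
  by (simp add: connection_set_def)

text \<open>Adjacent and non-adjacent pairs have equally many common neighbors here. Translating by
  \<open>p\<close> leaves a count that depends on \<open>u = q - p\<close> only and is checked for
  every nonzero \<open>u\<close>.\<close>

lemma card_common_neighbors_shrikhande:
  assumes "p \<noteq> q"
  shows "card {r. r - p \<in> connection_set \<and> r - q \<in> connection_set} = 2"
proof -
  define u where "u = q - p"
  obtain x y where u: "u = (x, y)" by fastforce
  have "{r. r - p \<in> connection_set \<and> r - q \<in> connection_set} = (+) p ` {c \<in> connection_set. c - u \<in> connection_set}"
  proof (intro equalityI subsetI)
    fix r assume "r \<in> {r. r - p \<in> connection_set \<and> r - q \<in> connection_set}"
    then have "r - p \<in> {c \<in> connection_set. c - u \<in> connection_set}" by (simp add: u_def)
    then show "r \<in> (+) p ` {c \<in> connection_set. c - u \<in> connection_set}"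
      by (intro image_eqI[of _ _ "r - p"]) simp_all
  qed (auto simp: u_def algebra_simps)
  then have "card {r. r - p \<in> connection_set \<and> r - q \<in> connection_set} = card {c \<in> connection_set. c - u \<in> connection_set}"
    by (simp add: card_image)
  also have "\<dots> = (\<Sum>c\<in>connection_set. if c - u \<in> connection_set then 1 else 0)"
    by (subst sum.inter_filter[symmetric]) (simp_all)
  also have "\<dots> = 2"
  proof -
    have "u \<noteq> 0" using assms by (simp add: u_def)
    then show ?thesis
      using cases_4[of x] cases_4[of y] unfolding u
      by (elim disjE; simp add: connection_set_def zero_prod_def)
  qed
  finally show ?thesis .
qed

lemma pair_graph_prism: "pair_graph (shrikhande_prism t)"
proof
  let ?G = "shrikhande_prism t"
  show "finite (pverts ?G)" by (simp add: pverts_prism)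
  have sub: "parcs ?G \<subseteq> pverts ?G \<times> pverts ?G"
    by (auto simp: cartesian_product_def)
  then show "finite (parcs ?G)" by (rule finite_subset) (simp add: pverts_prism)
  show "fst e \<in> pverts ?G" "snd e \<in> pverts ?G" if "e \<in> parcs ?G" for e
    using that sub by auto
  show "fst e \<noteq> snd e" if "e \<in> parcs ?G" for e
    using that zero_notin_connection_set by (cases e; cases "fst e"; cases "snd e")
      (auto simp: parcs_prism)
  show "symmetric (with_proj ?G)"
    unfolding symmetric_def
  proof (rule symI)
    fix u v assume uv: "(u, v) \<in> arcs_ends (with_proj ?G)"
    obtain p i q j where "u = (p, i)" "v = (q, j)" by (cases u, cases v)
    then show "(v, u) \<in> arcs_ends (with_proj ?G)"
      using uv diff_in_connection_set_commute[of q p] by (auto simp: parcs_prism)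
  qed
qed

lemma neighbors_prism:
  assumes "i < t"
  shows "neighbors (shrikhande_prism t) (p, i) = (\<lambda>c. (p + c, i)) ` connection_set \<union> Pair p ` ({..<t} - {i})"
proof (intro equalityI subsetI)
  fix v assume "v \<in> neighbors (shrikhande_prism t) (p, i)"
  then obtain q j where v: "v = (q, j)" "j < t" "p = q \<and> i \<noteq> j \<or> i = j \<and> q - p \<in> connection_set"
    by (cases v) (auto simp: neighbors_def parcs_prism)
  then consider "p = q" "i \<noteq> j" | "i = j" "q - p \<in> connection_set" by blast
  then show "v \<in> (\<lambda>c. (p + c, i)) ` connection_set \<union> Pair p ` ({..<t} - {i})"
  proof cases
    case 2
    then have "v = (p + (q - p), i)" using v by simp
    then show ?thesis using 2 by blast
  qed (use v in auto)
next
  fix v assume "v \<in> (\<lambda>c. (p + c, i)) ` connection_set \<union> Pair p ` ({..<t} - {i})"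
  then show "v \<in> neighbors (shrikhande_prism t) (p, i)"
    using assms by (auto simp: neighbors_def parcs_prism)
qed

lemma card_neighbors_prism:
  assumes "i < t"
  shows "card (neighbors (shrikhande_prism t) (p, i)) = t + 5"
proof -
  have "card ((\<lambda>c. (p + c, i)) ` connection_set) = 6"
    by (subst card_image) (simp_all add: inj_on_def card_connection_set)
  moreover have "card (Pair p ` ({..<t} - {i})) = t - 1"
    using assms by (subst card_image) (simp_all add: inj_on_def)
  moreover have "(\<lambda>c. (p + c, i)) ` connection_set \<inter> Pair p ` ({..<t} - {i}) = {}" by auto
  ultimately show ?thesis
    using assms by (simp add: neighbors_prism card_Un_disjoint)
qed

lemma card_common_neighbors_prism:
  assumes ij: "i < t" "j < t" and dist: "graph_dist (shrikhande_prism t) (p, i) (q, j) = 2"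
  shows "card (neighbors (shrikhande_prism t) (p, i) \<inter> neighbors (shrikhande_prism t) (q, j)) = 2"
proof -
  let ?G = "shrikhande_prism t"
  interpret pair_graph ?G by (rule pair_graph_prism)
  have ne: "(p, i) \<noteq> (q, j)" and nadj: "((p, i), (q, j)) \<notin> parcs ?G"
    and "\<exists>z. ((p, i), z) \<in> parcs ?G \<and> (z, (q, j)) \<in> parcs ?G"
    using graph_dist_eq_2D[OF pair_wf_digraph _ _ dist] ij by (auto simp: pverts_prism)
  then obtain r k where z: "((p, i), (r, k)) \<in> parcs ?G" "((r, k), (q, j)) \<in> parcs ?G" by auto
  \<comment> \<open>Otherwise both vertices lie in one copy of the complete graph and are equal or
    adjacent.\<close>
  have pq: "p \<noteq> q" using ne nadj ij by (auto simp: parcs_prism)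
  show ?thesis
  proof (cases "i = j")
    case True
    have "neighbors ?G (p, i) \<inter> neighbors ?G (q, j) = (\<lambda>r. (r, i)) ` {r. r - p \<in> connection_set \<and> r - q \<in> connection_set}"
      using True ij pq by (auto simp: neighbors_def parcs_prism)
    then show ?thesis
      by (simp add: card_image inj_on_def card_common_neighbors_shrikhande[OF pq])
  next
    case False
    \<comment> \<open>One step of the walk changes the layer and the other is a Shrikhande edge; the
      common neighbors are the two other corners of the resulting square.\<close>
    then have "q - p \<in> connection_set"
      using z pq by (auto simp: parcs_prism)
    then have "p - q \<in> connection_set" using diff_in_connection_set_commute by blast
    have "neighbors ?G (p, i) \<inter> neighbors ?G (q, j) = {(p, j), (q, i)}"
      using False ij pq \<open>q - p \<in> connection_set\<close> \<open>p - q \<in> connection_set\<close>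
      by (auto simp: neighbors_def parcs_prism)
    then show ?thesis using pq by simp
  qed
qed

lemma sesqui_regular_prism: "sesqui_regular (shrikhande_prism t) (16 * t) (t + 5) 2"
  unfolding sesqui_regular_def
  by (intro conjI pair_graph_prism)
    (auto simp: pverts_prism card_cartesian_product card_neighbors_prism card_common_neighbors_prism)

section \<open>Connectedness\<close>

lemma connected_prism:
  assumes "t > 0"
  shows "Digraph_Component.connected (with_proj (shrikhande_prism t))"
proof -
  let ?G = "with_proj (shrikhande_prism t)"
  interpret pair_graph "shrikhande_prism t" by (rule pair_graph_prism)
  have step: "(p, i) \<rightarrow>\<^sup>*\<^bsub>?G\<^esub> (p + c, i)" if "i < t" "c \<in> connection_set" for p c i
    using that by (intro reachable_adjI) (simp add: parcs_prism)
  \<comment> \<open>The iterate is the \<open>k\<close>-fold multiple of \<open>c\<close>. Multiples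
    of (1,0) and (0,1) then reach the whole layer, and one more edge changes the layer.\<close>
  have steps: "(p, i) \<rightarrow>\<^sup>*\<^bsub>?G\<^esub> (p + ((+) c ^^ k) 0, i)" if "i < t" "c \<in> connection_set" for p c i k
  proof (induction k)
    case 0
    then show ?case using that reachable_refl[of "(p, i)"] by (simp add: pverts_prism)
  next
    case (Suc k)
    have "(p + ((+) c ^^ k) 0, i) \<rightarrow>\<^sup>*\<^bsub>?G\<^esub> (p + ((+) c ^^ k) 0 + c, i)"
      by (rule step[OF that])
    with Suc have "(p, i) \<rightarrow>\<^sup>*\<^bsub>?G\<^esub> (p + ((+) c ^^ k) 0 + c, i)"
      by (rule reachable_trans)
    then show ?case by (simp add: add.assoc add.commute[of "((+) c ^^ k) 0" c])
  qed
  have coord: "(p, i) \<rightarrow>\<^sup>*\<^bsub>?G\<^esub> (p + (x, 0), i)" "(p, i) \<rightarrow>\<^sup>*\<^bsub>?G\<^esub> (p + (0, x), i)"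
    if "i < t" for p x i
  proof -
    obtain k :: nat where "x = of_nat k"
      using cases_4[of x] by (metis of_nat_0 of_nat_1 of_nat_numeral)
    moreover have "((+) (1, 0) ^^ k) 0 = (of_nat k :: 4, 0 :: 4)"
      "((+) (0, 1) ^^ k) 0 = (0 :: 4, of_nat k :: 4)"
      by (induction k) (simp_all add: zero_prod_def)
    ultimately show "(p, i) \<rightarrow>\<^sup>*\<^bsub>?G\<^esub> (p + (x, 0), i)" "(p, i) \<rightarrow>\<^sup>*\<^bsub>?G\<^esub> (p + (0, x), i)"
      using steps[OF that, of "(1, 0)" p k] steps[OF that, of "(0, 1)" p k] by (simp_all add: connection_set_def)
  qed
  have all: "(p, i) \<rightarrow>\<^sup>*\<^bsub>?G\<^esub> (q, j)" if ij: "i < t" "j < t" for p q i j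
  proof -
    obtain x y where xy: "q - p = (x, y)" by fastforce
    have "(p, i) \<rightarrow>\<^sup>*\<^bsub>?G\<^esub> (p + (x, 0) + (0, y), i)"
      using coord[OF ij(1)] reachable_trans by blast
    also have "p + (x, 0) + (0, y) = q"
      using xy by (simp add: add.assoc diff_eq_eq add.commute)
    also have "(q, i) \<rightarrow>\<^sup>*\<^bsub>?G\<^esub> (q, j)"
      using ij by (cases "i = j") (auto simp: pverts_prism parcs_prism intro: reachable_adjI)
    finally show ?thesis .
  qed
  have "\<forall>u\<in>pverts (shrikhande_prism t). \<forall>v\<in>pverts (shrikhande_prism t). u \<rightarrow>\<^sup>*\<^bsub>mk_symmetric ?G\<^esub> v"
    using all reachable_mk_symmetricI by (auto simp: pverts_prism)
  moreover have "pverts (shrikhande_prism t) \<noteq> {}"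
    using assms by (auto simp: pverts_prism)
  ultimately show ?thesis
    unfolding Digraph_Component.connected_def strongly_connected_def by simp
qed

section \<open>The smallest eigenvalue\<close>

lemma sum_connection_set: "(\<Sum>q\<in>UNIV. of_bool (q - p \<in> connection_set) * f q) = (\<Sum>c\<in>connection_set. f (p + c))"
  for f :: "4 \<times> 4 \<Rightarrow> real"
proof -
  have "(\<Sum>q\<in>UNIV. of_bool (q - p \<in> connection_set) * f q) = (\<Sum>q\<in>(+) p ` connection_set. f q)"
    by (rule sum.mono_neutral_cong_right) (auto simp: of_bool_def intro: image_eqI[of _ _ "q - p" for q])
  then show ?thesis by (simp add: sum.reindex)
qed

text \<open>The adjacency operator is A tensor I plus I tensor (J - I), with A that of the
  Shrikhande graph and J the all-ones matrix of order \<open>t\<close>.\<close>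

lemma adjacency_sum_prism:
  fixes f :: "(4 \<times> 4) \<times> nat \<Rightarrow> real"
  assumes "i < t"
  shows "(\<Sum>v\<in>pverts (shrikhande_prism t). of_bool (((p, i), v) \<in> parcs (shrikhande_prism t)) * f v) =
    (\<Sum>q\<in>UNIV. of_bool (q - p \<in> connection_set) * f (q, i)) + (\<Sum>j<t. f (p, j)) - f (p, i)"
proof -
  have "(\<Sum>v\<in>pverts (shrikhande_prism t). of_bool (((p, i), v) \<in> parcs (shrikhande_prism t)) * f v) =
      (\<Sum>q\<in>UNIV. \<Sum>j<t. of_bool (((p, i), q, j) \<in> parcs (shrikhande_prism t)) * f (q, j))"
    by (simp add: pverts_prism sum.cartesian_product case_prod_unfold del: sum_of_bool_mult_eq sum_mult_of_bool_eq)
  also have "\<dots> = (\<Sum>q\<in>UNIV. \<Sum>j<t. (if i = j then of_bool (q - p \<in> connection_set) * f (q, j) else 0) +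
      (if p = q then f (q, j) - (if i = j then f (q, j) else 0) else 0))"
    using assms zero_notin_connection_set by (intro sum.cong refl) (auto simp: parcs_prism)
  also have "\<dots> = (\<Sum>q\<in>UNIV. of_bool (q - p \<in> connection_set) * f (q, i) +
      (if p = q then (\<Sum>j<t. f (q, j)) - f (q, i) else 0))"
    using assms by (intro sum.cong refl) (simp add: sum.distrib sum_subtractf)
  also have "\<dots> = (\<Sum>q\<in>UNIV. of_bool (q - p \<in> connection_set) * f (q, i)) + (\<Sum>j<t. f (p, j)) - f (p, i)"
    by (simp add: sum.distrib)
  finally show ?thesis .
qed

lemma eigenvalue_prism_minus_3:
  assumes "t \<ge> 2"
  shows "eigenvalue (adjacency_matrix (shrikhande_prism t)) (-3)"
proof -
  \<comment> \<open>Alternating signs on the 4-cycle of the points (x,0). A vertex off this cycle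
    has there either no neighbor or two consecutive ones, whose signs cancel; so \<open>g\<close>
    has eigenvalue -2.\<close>
  define g :: "4 \<times> 4 \<Rightarrow> real" where
    "g p = (if snd p = 0 then if fst p = 0 \<or> fst p = 2 then 1 else -1 else 0)" for p
  \<comment> \<open>The second factor has sum 0, so it is an eigenvector of the complete graph for
    -1, and the eigenvalues add up to -3.\<close>
  define f :: "(4 \<times> 4) \<times> nat \<Rightarrow> real" where
    "f v = g (fst v) * (of_bool (snd v = 0) - of_bool (snd v = 1))" for v
  have g: "(\<Sum>q\<in>UNIV. of_bool (q - p \<in> connection_set) * g q) = -2 * g p" for p
  proof -
    obtain x y where p: "p = (x, y)" by fastforce
    show ?thesis unfolding sum_connection_set p
      using cases_4[of x] cases_4[of y] by (elim disjE) (simp_all add: connection_set_def g_def)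
  qed
  have "(\<Sum>j<t. of_bool (j = 0) - of_bool (j = 1) :: real) = 0"
    using assms by (simp add: sum_subtractf of_bool_def)
  then have "(\<Sum>j<t. f (p, j)) = 0" for p
    by (simp add: f_def sum_distrib_left[symmetric])
  moreover have "(\<Sum>q\<in>UNIV. of_bool (q - p \<in> connection_set) * f (q, i)) = -2 * f (p, i)" for p i
    using g[of p] by (simp add: f_def sum_distrib_right[symmetric] flip: mult.assoc)
  ultimately have "(\<Sum>v\<in>pverts (shrikhande_prism t). of_bool ((x, v) \<in> parcs (shrikhande_prism t)) * f v) =
      -3 * f x" if "x \<in> pverts (shrikhande_prism t)" for x
    using that adjacency_sum_prism[of "snd x" t "fst x" f] by (simp add: pverts_prism mem_Times_iff)
  moreover have "f ((0, 0), 0) \<noteq> 0" "((0, 0), 0) \<in> pverts (shrikhande_prism t)"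
    using assms by (simp_all add: f_def g_def pverts_prism)
  moreover have "finite (pverts (shrikhande_prism t))" by (simp add: pverts_prism)
  ultimately show ?thesis by (subst eigenvalue_adjacency_matrix_iff) blast+
qed

text \<open>By \<open>phi_sum\<close>, twice the form of A + 2I is the sum of the squared inner
  products of \<open>h\<close> with the seven functions.\<close>

lemma shrikhande_form_nonneg:
  fixes h :: "4 \<times> 4 \<Rightarrow> real"
  shows "(\<Sum>p\<in>UNIV. h p * (\<Sum>q\<in>UNIV. of_bool (q - p \<in> connection_set) * h q)) + 2 * (\<Sum>p\<in>UNIV. (h p)\<^sup>2) \<ge> 0"
proof -
  have "0 \<le> (\<Sum>a<7. (\<Sum>p\<in>UNIV. phi a p * h p)\<^sup>2)"
    by (intro sum_nonneg) simp
  also have "\<dots> = (\<Sum>a<7. \<Sum>p\<in>UNIV. \<Sum>q\<in>UNIV. h p * h q * of_int (phi a p * phi a q))"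
    by (simp add: power2_eq_square sum_product mult_ac)
  also have "\<dots> = (\<Sum>p\<in>UNIV. \<Sum>a<7. \<Sum>q\<in>UNIV. h p * h q * of_int (phi a p * phi a q))"
    by (rule sum.swap)
  also have "\<dots> = (\<Sum>p\<in>UNIV. \<Sum>q\<in>UNIV. h p * h q * of_int (\<Sum>a<7. phi a p * phi a q))"
    by (intro sum.cong refl, subst sum.swap) (simp add: sum_distrib_left)
  also have "\<dots> = (\<Sum>p\<in>UNIV. \<Sum>q\<in>UNIV. 2 * (h p * (of_bool (q - p \<in> connection_set) * h q)) + (if p = q then 4 * (h p)\<^sup>2 else 0))"
    unfolding phi_sum using zero_notin_connection_set
    by (intro sum.cong refl) (auto simp: power2_eq_square)
  also have "\<dots> = 2 * ((\<Sum>p\<in>UNIV. h p * (\<Sum>q\<in>UNIV. of_bool (q - p \<in> connection_set) * h q)) + 2 * (\<Sum>p\<in>UNIV. (h p)\<^sup>2))"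
    by (simp add: sum.distrib sum_distrib_left del: sum_of_bool_mult_eq sum_mult_of_bool_eq)
  finally show ?thesis by simp
qed

text \<open>Adding 3I to the adjacency operator gives (A + 2I) tensor I plus I tensor J. At an
  eigenvector its form is a sum of nonnegative layer terms and squares of the sums over the copies
  of the complete graph.\<close>

lemma eigenvalue_prism_ge:
  assumes "eigenvalue (adjacency_matrix (shrikhande_prism t)) k"
  shows "-3 \<le> k"
proof -
  let ?V = "pverts (shrikhande_prism t)"
  have fin: "finite ?V" by (simp add: pverts_prism)
  obtain f x where x: "x \<in> ?V" "f x \<noteq> 0"
    and f: "\<And>x. x \<in> ?V \<Longrightarrow> (\<Sum>y\<in>?V. of_bool ((x, y) \<in> parcs (shrikhande_prism t)) * f y) = k * f x"
    using assms eigenvalue_adjacency_matrix_iff[OF fin] by blast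
  let ?A = "\<lambda>p i. \<Sum>q\<in>UNIV. of_bool (q - p \<in> connection_set) * f (q, i)"
  have eq: "(k + 3) * (f (p, i))\<^sup>2 = f (p, i) * ?A p i + 2 * (f (p, i))\<^sup>2 + f (p, i) * (\<Sum>j<t. f (p, j))"
    if "i < t" for p i
  proof -
    have *: "k * f (p, i) = ?A p i + (\<Sum>j<t. f (p, j)) - f (p, i)"
      using f[of "(p, i)"] adjacency_sum_prism[OF that, of p f] that by (simp add: pverts_prism)
    have "(k + 3) * (f (p, i))\<^sup>2 = f (p, i) * (k * f (p, i)) + 3 * (f (p, i))\<^sup>2"
      by (simp add: power2_eq_square algebra_simps)
    also have "\<dots> = f (p, i) * ?A p i + 2 * (f (p, i))\<^sup>2 + f (p, i) * (\<Sum>j<t. f (p, j))"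
      unfolding * power2_eq_square by (simp only: ring_distribs)
    finally show ?thesis .
  qed
  have "(k + 3) * (\<Sum>v\<in>?V. (f v)\<^sup>2) = (\<Sum>p\<in>UNIV. \<Sum>i<t. (k + 3) * (f (p, i))\<^sup>2)"
    by (simp add: pverts_prism sum.cartesian_product case_prod_unfold sum_distrib_left)
  also have "\<dots> = (\<Sum>p\<in>UNIV. \<Sum>i<t. f (p, i) * ?A p i + 2 * (f (p, i))\<^sup>2 +
      f (p, i) * (\<Sum>j<t. f (p, j)))"
    by (intro sum.cong refl eq) simp
  also have "\<dots> = (\<Sum>p\<in>UNIV. \<Sum>i<t. f (p, i) * ?A p i + 2 * (f (p, i))\<^sup>2) +
      (\<Sum>p\<in>UNIV. (\<Sum>j<t. f (p, j))\<^sup>2)"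
    by (simp add: sum.distrib power2_eq_square sum_distrib_right del: sum_of_bool_mult_eq sum_mult_of_bool_eq)
  also have "(\<Sum>p\<in>UNIV. \<Sum>i<t. f (p, i) * ?A p i + 2 * (f (p, i))\<^sup>2) =
      (\<Sum>i<t. (\<Sum>p\<in>UNIV. f (p, i) * ?A p i) + 2 * (\<Sum>p\<in>UNIV. (f (p, i))\<^sup>2))"
    by (subst sum.swap) (simp add: sum.distrib sum_distrib_left del: sum_of_bool_mult_eq sum_mult_of_bool_eq)
  also have "\<dots> + (\<Sum>p\<in>UNIV. (\<Sum>j<t. f (p, j))\<^sup>2) \<ge> 0"
    by (intro add_nonneg_nonneg sum_nonneg shrikhande_form_nonneg) simp
  finally have "0 \<le> (k + 3) * (\<Sum>v\<in>?V. (f v)\<^sup>2)" .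
  moreover have "0 < (\<Sum>v\<in>?V. (f v)\<^sup>2)"
    using x fin by (intro sum_pos2[of _ x]) auto
  ultimately show ?thesis by (simp add: zero_le_mult_iff)
qed

lemma lambda_min_prism:
  assumes "t \<ge> 2"
  shows "lambda_min (shrikhande_prism t) = -3"
  unfolding lambda_min_def
proof (rule Min_eqI)
  show "-3 \<in> {k. eigenvalue (adjacency_matrix (shrikhande_prism t)) k}"
    using eigenvalue_prism_minus_3[OF assms] by simp
qed (auto intro: eigenvalue_prism_ge finite_eigenvalues_adjacency_matrix)

section \<open>Non-integrability of the products\<close>

lemma not_one_integrable_prism:
  assumes "t \<ge> 2"
  shows "\<not> s_integrable 1 (shrikhande_prism t)"
proof
  assume int: "s_integrable 1 (shrikhande_prism t)"
  have fin: "finite (pverts (shrikhande_prism t))" by (simp add: pverts_prism)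
  obtain F :: "(4 \<times> 4) \<times> nat \<Rightarrow> nat \<Rightarrow> int" and m where
    F: "\<And>x y. x \<in> pverts (shrikhande_prism t) \<Longrightarrow> y \<in> pverts (shrikhande_prism t) \<Longrightarrow>
      (\<Sum>r<m. F x r * F y r) = of_bool ((x, y) \<in> parcs (shrikhande_prism t)) +
        (if x = y then \<lceil>- lambda_min (shrikhande_prism t)\<rceil> else 0)"
    by (rule one_integrable_gram[OF fin int]) (rule that)
  have F': "(\<Sum>r<m. F (p, i) r * F (q, j) r) =
      of_bool (p = q \<and> i \<noteq> j \<or> i = j \<and> q - p \<in> connection_set) + (if p = q \<and> i = j then 3 else 0)"
    if "i < t" "j < t" for p q i j
    using F[of "(p, i)" "(q, j)"] that lambda_min_prism[OF assms] by (simp add: pverts_prism parcs_prism)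
  show False
    \<comment> \<open>Layers 0 and 1 exist because \<open>t\<close> is at least 2, and their
      representing vectors are already contradictory.\<close>
    by (rule no_integral_shrikhande_layers[of "{..<m}" "\<lambda>p. F (p, 0)" "\<lambda>p. F (p, 1)"])
      (use assms zero_notin_connection_set in \<open>auto simp: F'\<close>)
qed

theorem theorem1p6:
  fixes t :: nat
  assumes "t \<ge> 2"
  defines "\<Gamma> \<equiv> shrikhande_graph \<box> complete_graph t"
  shows "Digraph_Component.connected (with_proj \<Gamma>)
    \<and> sesqui_regular \<Gamma> (16 * t) (t + 5) 2
    \<and> lambda_min \<Gamma> = -3
    \<and> \<not> s_integrable 1 \<Gamma>"
  unfolding \<Gamma>_def
proof (intro conjI)
  show "Digraph_Component.connected (with_proj (shrikhande_prism t))"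
    using assms(1) by (intro connected_prism) simp
qed (rule sesqui_regular_prism lambda_min_prism[OF assms(1)] not_one_integrable_prism[OF assms(1)])+

end
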